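(* The convex hull of any trigonometric curve is a projected spectrahedron. In particular, for every $A=(a_1,\dots,a_d)\in\mathbb{N}^d$, the Carathéodory orbitope $$\mathcal{C}_A=\mathrm{conv}\bigl\{(\cos a_1\theta,\sin a_1\theta,\dots,\cos a_d\theta,\sin a_d\theta)\in\mathbb{R}^{2d}:\theta\in[0,2\pi)\bigr\}$$ is a projected spectrahedron.
   Context: A trigonometric curve is a curve in some $\mathbb{R}^n$ of the form $\{(f_1(\theta),\dots,f_n(\theta)):\theta\in[0,2\pi)\}$, where each $f_i$ is a real polynomial in $\cos\theta$ and $\sin\theta$. A spectrahedron is a set of the form $\{x\in\mathbb{R}^N:A_0+x_1A_1+\cdots+x_NA_N\succeq0\}$ with $A_0,\dots,A_N$ real symmetric matrices and $\succeq0$ denoting positive semidefiniteness. A projected spectrahedron is the image of a spectrahedron under a linear (affine) map. *)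

theory Defs
  imports "HOL-Analysis.Analysis" "HOL-Computational_Algebra.Polynomial" "Jordan_Normal_Form.Matrix"
begin

text \<open>
  The dimension \<open>N\<close> of a spectrahedron and the size \<open>m\<close> of the matrices describing it are
  existentially quantified below, so both are numbers rather than types: points of \<open>\<real>\<^sup>N\<close> and
  matrices are those of Jordan_Normal_Form. The space \<open>\<real>\<^sup>n\<close> containing a curve and its convex hull is
  the type \<open>real^'n\<close>. Both theories use the name \<open>vec\<close> and the symbol \<open>$\<close>; the constants of
  Jordan_Normal_Form are therefore written in prefix form.
\<close>

definition psd_mat :: "nat \<Rightarrow> real mat \<Rightarrow> bool" where
  "psd_mat m M \<longleftrightarrow> M \<in> carrier_mat m m \<and> transpose_mat M = M \<and>
     (\<forall>v \<in> carrier_vec m. scalar_prod v (mult_mat_vec M v) \<ge> 0)"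

text \<open>\<open>A\<^sub>0 + x\<^sub>1 A\<^sub>1 + \<dots> + x\<^sub>N A\<^sub>N\<close>; coordinates of \<open>x\<close> count from \<open>0\<close>, whence the index shift.\<close>

definition matrix_pencil :: "nat \<Rightarrow> nat \<Rightarrow> (nat \<Rightarrow> real mat) \<Rightarrow> real Matrix.vec \<Rightarrow> real mat" where
  "matrix_pencil m N A x =
     Matrix.mat m m (\<lambda>(i, j). index_mat (A 0) (i, j) + (\<Sum>k<N. vec_index x k * index_mat (A (Suc k)) (i, j)))"

definition spectrahedron :: "nat \<Rightarrow> real Matrix.vec set \<Rightarrow> bool" where
  "spectrahedron N S \<longleftrightarrow>
     (\<exists>m A. (\<forall>k\<le>N. A k \<in> carrier_mat m m \<and> transpose_mat (A k) = A k) \<and>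
            S = {x \<in> carrier_vec N. psd_mat m (matrix_pencil m N A x)})"

definition affine_map :: "nat \<Rightarrow> (real Matrix.vec \<Rightarrow> real^'n) \<Rightarrow> bool" where
  "affine_map N f \<longleftrightarrow>
     (\<exists>b c. \<forall>x \<in> carrier_vec N. f x = b + (\<Sum>k<N. vec_index x k *\<^sub>R c k))"

definition projected_spectrahedron :: "(real^'n) set \<Rightarrow> bool" where
  "projected_spectrahedron P \<longleftrightarrow>
     (\<exists>N S f. spectrahedron N S \<and> affine_map N f \<and> P = f ` S)"

text \<open>A polynomial in two variables is a polynomial in the second one whose coefficients are
  polynomials in the first one.\<close>

definition trigonometric_polynomial :: "(real \<Rightarrow> real) \<Rightarrow> bool" where
  "trigonometric_polynomial f \<longleftrightarrow>
     (\<exists>p :: real poly poly. \<forall>\<theta>. f \<theta> = poly (poly p [:sin \<theta>:]) (cos \<theta>))"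

definition trigonometric_curve :: "(real^'n) set \<Rightarrow> bool" where
  "trigonometric_curve C \<longleftrightarrow>
     (\<exists>f :: 'n \<Rightarrow> real \<Rightarrow> real. (\<forall>i. trigonometric_polynomial (f i)) \<and>
        C = (\<lambda>\<theta>. \<chi> i. f i \<theta>) ` {0..<2 * pi})"

text \<open>
  \<open>\<real>\<^sup>2\<^sup>d\<close> is \<open>real^('d \<times> 2)\<close>: the coordinates \<open>(j, 1)\<close> and \<open>(j, 2)\<close> carry
  \<open>cos a\<^sub>j\<theta>\<close> and \<open>sin a\<^sub>j\<theta>\<close>.
\<close>

definition caratheodory_orbitope :: "nat^'d \<Rightarrow> (real^('d \<times> 2)) set" where
  "caratheodory_orbitope a =
     convex hull ((\<lambda>\<theta>. \<chi> p. if snd p = 1 then cos (real (vec_nth a (fst p)) * \<theta>)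
                                  else sin (real (vec_nth a (fst p)) * \<theta>)) ` {0..<2 * pi})"

end

theory Submission
  imports Defs "HOL-Computational_Algebra.Fundamental_Theorem_Algebra"
begin

text \<open>
  Write \<open>c = cos (\<theta>/2)\<close> and \<open>s = sin (\<theta>/2)\<close>. Since \<open>1 = c\<^sup>2 + s\<^sup>2\<close>, \<open>cos \<theta> = c\<^sup>2 - s\<^sup>2\<close> and
  \<open>sin \<theta> = 2cs\<close>, every trigonometric polynomial is a binary form of some even degree \<open>2d\<close> in
  \<open>(c, s)\<close>, and finitely many of them can be given the same \<open>d\<close>
  (\<open>trigonometric_polynomial_half_angle\<close>, \<open>half_angle_mono\<close>). A form is encoded by the univariate
  polynomial \<open>p\<close> with the same coefficients, of degree at most \<open>2d\<close>. Let the curve be given by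
  \<open>p\<^sub>1, \<dots>, p\<^sub>n\<close> and let \<open>w\<close> encode the constant function \<open>1\<close>.

  A sequence \<open>y\<^sub>0, \<dots>, y\<^sub>2\<^sub>d\<close> is the same as a linear functional \<open>L\<close> on the polynomials of degree at
  most \<open>2d\<close>. The Hankel matrix \<open>(y\<^sub>i\<^sub>+\<^sub>j)\<close> is positive semidefinite iff \<open>L (g\<^sup>2) \<ge> 0\<close> for all \<open>g\<close> of
  degree at most \<open>d\<close>. As \<open>w\<close> has constant coefficient \<open>1\<close>, the equation \<open>L w = 1\<close> can be solved for
  \<open>y\<^sub>0\<close>, so the functionals with both properties form a spectrahedron in the coordinates
  \<open>y\<^sub>1, \<dots>, y\<^sub>2\<^sub>d\<close> (\<open>hankel_image_projected_spectrahedron\<close>). Its image under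
  \<open>L \<mapsto> (L p\<^sub>1, \<dots>, L p\<^sub>n)\<close> is the convex hull of the curve (\<open>hankel_image_eq_convex_hull\<close>).
  The image contains the curve because evaluation at an angle is such a functional. Conversely, a
  point \<open>(L p\<^sub>1, \<dots>, L p\<^sub>n)\<close> outside the compact convex hull would be strictly separated from it by
  some \<open>a, b\<close>; then \<open>q = \<Sum> a\<^sub>i p\<^sub>i - b w\<close> is positive on the real line, hence a sum of two squares
  (\<open>pos_poly_sum_two_squares\<close>), and \<open>L q \<ge> 0\<close> contradicts the separation.
\<close>

section \<open>Positive univariate polynomials are sums of two squares\<close>

text \<open>
  A nonconstant positive polynomial has a complex root \<open>z\<close> off the real line, and then the real
  quadratic \<open>(x - Re z)\<^sup>2 + (Im z)\<^sup>2\<close> divides it: the remainder is a real polynomial of degree at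
  most one that vanishes at the nonreal point \<open>z\<close>.
\<close>

lemma pos_poly_quadratic_factor:
  fixes p :: "real poly"
  assumes pos: "\<And>t. poly p t > 0" and deg: "degree p > 0"
  obtains a b s where "b \<noteq> 0" "p = ([:- a, 1:]\<^sup>2 + [:b:]\<^sup>2) * s"
proof -
  define P where "P = map_poly complex_of_real p"
  have ev: "poly (map_poly complex_of_real r) (of_real x) = of_real (poly r x)" for r x
    by (induction r) (auto simp: map_poly_pCons)
  have "degree P > 0"
    using deg by (simp add: P_def degree_map_poly)
  then have "\<not> constant (poly P)"
    by (simp add: constant_degree)
  then obtain z where z: "poly P z = 0"
    using fundamental_theorem_of_algebra by blast
  define w where "w = [:- Re z, 1:]\<^sup>2 + [:Im z:]\<^sup>2"
  have Im: "Im z \<noteq> 0"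
  proof
    assume "Im z = 0"
    then have "z = of_real (Re z)"
      by (simp add: complex_eq_iff)
    then have "poly p (Re z) = 0"
      using z ev[of p "Re z"] by (metis P_def of_real_eq_0_iff)
    then show False
      using pos[of "Re z"] by simp
  qed
  have w_eq: "w = [:(Re z)\<^sup>2 + (Im z)\<^sup>2, - 2 * Re z, 1:]"
    by (simp add: w_def power2_eq_square)
  have "degree w = 2"
    by (simp add: w_eq)
  then have "degree (p mod w) < 2"
    by (metis degree_0 degree_mod_less pos2 zero_neq_numeral)
  then obtain \<alpha> \<beta> where r: "p mod w = [:\<alpha>, \<beta>:]"
    by (metis degree_pCons_eq_if less_2_cases_iff degree_eq_zeroE
        nat.inject pCons_0_0 pCons_cases)
  have "poly (map_poly complex_of_real w) z = 0"
    by (simp add: w_eq map_poly_pCons complex_eq_iff power2_eq_square algebra_simps)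
  moreover have "P = map_poly complex_of_real w * map_poly complex_of_real (p div w)
                     + map_poly complex_of_real (p mod w)"
  proof -
    have "map_poly complex_of_real (w * (p div w) + p mod w)
        = map_poly complex_of_real w * map_poly complex_of_real (p div w)
          + map_poly complex_of_real (p mod w)"
      by (simp only: poly_eq_iff coeff_map_poly coeff_add coeff_mult of_real_0 of_real_add
          of_real_sum of_real_mult) simp
    then show ?thesis
      by (simp add: P_def)
  qed
  ultimately have "poly (map_poly complex_of_real [:\<alpha>, \<beta>:]) z = 0"
    using z r by simp
  then have "of_real \<alpha> + z * of_real \<beta> = 0"
    by (simp add: map_poly_pCons)
  then have "\<alpha> = 0 \<and> \<beta> = 0"
    using Im by (auto simp: complex_eq_iff)
  then have "p = w * (p div w)"
    using r by (metis mod_0_imp_dvd dvd_mult_div_cancel pCons_0_0)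
  then show ?thesis
    using that Im unfolding w_def by blast
qed

text \<open>
  Sums of two squares are closed under products by the Brahmagupta identity
  \<open>(u\<^sup>2 + v\<^sup>2)(g\<^sup>2 + h\<^sup>2) = (ug - vh)\<^sup>2 + (uh + vg)\<^sup>2\<close>, so the quadratic factors can be absorbed one
  at a time.
\<close>

lemma pos_poly_sum_two_squares:
  fixes p :: "real poly"
  assumes "\<And>t. poly p t > 0"
  shows "\<exists>g h. p = g * g + h * h \<and> 2 * degree g \<le> degree p \<and> 2 * degree h \<le> degree p"
  using assms
proof (induction "degree p" arbitrary: p rule: less_induct)
  case less
  show ?case
  proof (cases "degree p = 0")
    case True
    then obtain c where c: "p = [:c:]"
      by (rule degree_eq_zeroE)
    with less.prems[of 0] have "p = [:sqrt c:] * [:sqrt c:] + 0 * 0"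
      by simp
    then show ?thesis
      by (intro exI[of _ "[:sqrt c:]"] exI[of _ 0]) simp
  next
    case False
    then obtain a b s where b: "b \<noteq> 0" and p: "p = ([:- a, 1:]\<^sup>2 + [:b:]\<^sup>2) * s"
      using pos_poly_quadratic_factor less.prems by (metis gr0I)
    have quad: "poly ([:- a, 1:]\<^sup>2 + [:b:]\<^sup>2) t > 0" for t
      using b by (simp add: sum_power2_gt_zero_iff)
    have s: "poly s t > 0" for t
      using less.prems[of t] quad[of t] unfolding p poly_mult
      by (simp only: zero_less_mult_iff) linarith
    have "s \<noteq> 0"
      using s[of 0] by auto
    have "degree ([:- a, 1:]\<^sup>2 + [:b:]\<^sup>2) = 2"
      by (simp add: power2_eq_square)
    then have deg: "degree p = 2 + degree s"
      unfolding p using \<open>s \<noteq> 0\<close> by (subst degree_mult_eq) auto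
    then obtain g h where gh: "s = g * g + h * h" "2 * degree g \<le> degree s" "2 * degree h \<le> degree s"
      using less.hyps[of s] s by auto
    define g' where "g' = [:- a, 1:] * g - [:b:] * h"
    define h' where "h' = [:- a, 1:] * h + [:b:] * g"
    have "p = g' * g' + h' * h'"
      unfolding p gh(1) g'_def h'_def by (simp only: power2_eq_square algebra_simps)
    moreover have lin: "degree ([:- a, 1:] * r) \<le> 1 + degree r" for r
      using degree_mult_le[of "[:- a, 1:]" r] by simp
    have const: "degree ([:b:] * r) \<le> degree r" for r
      by simp
    have "2 * degree g' \<le> degree p"
      unfolding g'_def using lin[of g] const[of h] gh deg
        degree_diff_le_max[of "[:- a, 1:] * g" "[:b:] * h"] by linarith
    moreover have "2 * degree h' \<le> degree p"
      unfolding h'_def using lin[of h] const[of g] gh deg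
        degree_add_le_max[of "[:- a, 1:] * h" "[:b:] * g"] by linarith
    ultimately show ?thesis
      by blast
  qed
qed

section \<open>Truncated moment functionals and Hankel forms\<close>

text \<open>
  The Riesz functional \<open>x\<^sup>k \<mapsto> y\<^sub>k\<close> of a truncated moment sequence. The bound \<open>n\<close> is a parameter, rather
  than the degree of the argument, to allow sums of polynomials of different degrees.
\<close>

definition riesz :: "nat \<Rightarrow> (nat \<Rightarrow> real) \<Rightarrow> real poly \<Rightarrow> real" where
  "riesz n y p = (\<Sum>k\<le>n. coeff p k * y k)"

lemma riesz_add: "riesz n y (p + q) = riesz n y p + riesz n y q"
  by (simp add: riesz_def sum.distrib algebra_simps)

lemma riesz_diff: "riesz n y (p - q) = riesz n y p - riesz n y q"
  by (simp add: riesz_def sum_subtractf algebra_simps)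

lemma riesz_smult: "riesz n y (Polynomial.smult c p) = c * riesz n y p"
  by (simp add: riesz_def sum_distrib_left algebra_simps)

lemma riesz_sum: "riesz n y (\<Sum>i\<in>I. P i) = (\<Sum>i\<in>I. riesz n y (P i))"
  by (induction I rule: infinite_finite_induct) (auto simp: riesz_add, auto simp: riesz_def)

lemma riesz_monom: "k \<le> n \<Longrightarrow> riesz n y (monom c k) = c * y k"
  by (simp add: riesz_def if_distrib[of "\<lambda>x. x * _"] cong: if_cong)

lemma riesz_mult:
  assumes "degree g \<le> d" "degree h \<le> d"
  shows "riesz (2 * d) y (g * h) = (\<Sum>i\<le>d. \<Sum>j\<le>d. coeff g i * coeff h j * y (i + j))"
proof -
  have "g * h = (\<Sum>i\<le>d. monom (coeff g i) i) * (\<Sum>j\<le>d. monom (coeff h j) j)"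
    using assms by (simp add: poly_as_sum_of_monoms')
  also have "\<dots> = (\<Sum>i\<le>d. \<Sum>j\<le>d. monom (coeff g i * coeff h j) (i + j))"
    by (simp add: sum_product mult_monom)
  finally show ?thesis
    by (simp add: riesz_sum riesz_monom)
qed

definition hankel_psd :: "nat \<Rightarrow> (nat \<Rightarrow> real) \<Rightarrow> bool" where
  "hankel_psd d y \<longleftrightarrow> (\<forall>g. degree g \<le> d \<longrightarrow> riesz (2 * d) y (g * g) \<ge> 0)"

lemma riesz_convex_comb:
  "riesz n (\<lambda>k. u * y k + v * z k) p = u * riesz n y p + v * riesz n z p"
  by (simp add: riesz_def sum_distrib_left sum.distrib algebra_simps)

text \<open>
  If \<open>v\<close> is the coefficient vector of \<open>g\<close>, the quadratic form of the Hankel matrix at \<open>v\<close> is the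
  value of the functional at \<open>g\<^sup>2\<close>.
\<close>

lemma hankel_psd_mat_iff:
  "psd_mat (Suc d) (Matrix.mat (Suc d) (Suc d) (\<lambda>(i, j). y (i + j))) \<longleftrightarrow> hankel_psd d y"
proof -
  define M where "M = Matrix.mat (Suc d) (Suc d) (\<lambda>(i, j). y (i + j))"
  have sym: "M \<in> carrier_mat (Suc d) (Suc d)" "transpose_mat M = M"
    by (auto simp: M_def add.commute)
  have quad: "scalar_prod v (mult_mat_vec M v) = riesz (2 * d) y (g * g)"
    if "v \<in> carrier_vec (Suc d)" "degree g \<le> d" "\<And>i. i \<le> d \<Longrightarrow> vec_index v i = coeff g i" for v g
    unfolding riesz_mult[OF that(2) that(2)] using that(1,3)
    by (simp add: M_def scalar_prod_def sum_distrib_left lessThan_Suc_atMost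
        atLeast0LessThan mult_ac)
  have "(\<forall>v \<in> carrier_vec (Suc d). scalar_prod v (mult_mat_vec M v) \<ge> 0) \<longleftrightarrow> hankel_psd d y"
  proof
    assume *: "\<forall>v \<in> carrier_vec (Suc d). scalar_prod v (mult_mat_vec M v) \<ge> 0"
    show "hankel_psd d y"
      unfolding hankel_psd_def
    proof (intro allI impI)
      fix g :: "real poly" assume "degree g \<le> d"
      then show "riesz (2 * d) y (g * g) \<ge> 0"
        using bspec[OF *, of "Matrix.vec (Suc d) (coeff g)"] quad[of "Matrix.vec (Suc d) (coeff g)" g]
        by simp
    qed
  next
    assume *: "hankel_psd d y"
    show "\<forall>v \<in> carrier_vec (Suc d). scalar_prod v (mult_mat_vec M v) \<ge> 0"
    proof
      fix v :: "real Matrix.vec" assume v: "v \<in> carrier_vec (Suc d)"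
      define g where "g = (\<Sum>i\<le>d. monom (vec_index v i) i)"
      have "degree g \<le> d"
        unfolding g_def by (intro degree_sum_le) (auto intro: order_trans[OF degree_monom_le])
      moreover have "coeff g i = vec_index v i" if "i \<le> d" for i
        using that by (simp add: g_def coeff_sum)
      ultimately show "scalar_prod v (mult_mat_vec M v) \<ge> 0"
        using * quad[of v g] v by (simp add: hankel_psd_def)
    qed
  qed
  then show ?thesis
    using sym by (simp add: psd_mat_def M_def)
qed

section \<open>Images of normalised Hankel functionals\<close>

definition hankel_image :: "nat \<Rightarrow> real poly \<Rightarrow> ('n \<Rightarrow> real poly) \<Rightarrow> (real^'n) set" where
  "hankel_image d w P =
     {(\<chi> i. riesz (2 * d) y (P i)) | y. hankel_psd d y \<and> riesz (2 * d) y w = 1}"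

lemma convex_hankel_image:
  fixes P :: "'n::finite \<Rightarrow> real poly"
  shows "convex (hankel_image d w P)"
proof (rule convexI)
  fix x1 x2 :: "real^'n" and u v :: real
  assume "x1 \<in> hankel_image d w P" "x2 \<in> hankel_image d w P" and uv: "0 \<le> u" "0 \<le> v" "u + v = 1"
  then obtain y z where x: "x1 = (\<chi> i. riesz (2 * d) y (P i))" "x2 = (\<chi> i. riesz (2 * d) z (P i))"
    and y: "hankel_psd d y" "riesz (2 * d) y w = 1" and z: "hankel_psd d z" "riesz (2 * d) z w = 1"
    unfolding hankel_image_def by auto
  let ?t = "\<lambda>k. u * y k + v * z k"
  have "hankel_psd d ?t" "riesz (2 * d) ?t w = 1"
    using y z uv by (auto simp: hankel_psd_def riesz_convex_comb)
  moreover have "u *\<^sub>R x1 + v *\<^sub>R x2 = (\<chi> i. riesz (2 * d) ?t (P i))"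
    by (simp add: x Finite_Cartesian_Product.vec_eq_iff riesz_convex_comb)
  ultimately show "u *\<^sub>R x1 + v *\<^sub>R x2 \<in> hankel_image d w P"
    unfolding hankel_image_def by blast
qed

text \<open>
  As \<open>w\<close> has constant coefficient \<open>1\<close>, the equation \<open>L w = 1\<close> just expresses \<open>y\<^sub>0\<close> as an affine
  function of \<open>y\<^sub>1, \<dots>, y\<^sub>2\<^sub>d\<close>. These serve as free coordinates, and both the Hankel matrix and the
  values \<open>L (P i)\<close> are affine in them, so no equation remains to be encoded as a matrix inequality.
\<close>

lemma hankel_image_projected_spectrahedron:
  fixes P :: "'n::finite \<Rightarrow> real poly"
  assumes w0: "coeff w 0 = 1"
  shows "projected_spectrahedron (hankel_image d w P)"
proof -
  \<comment> \<open>\<open>y x\<close> is the normalised sequence with \<open>y\<^sub>l\<^sub>+\<^sub>1 = x\<^sub>l\<close>; the correction term in the corner entry of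
    \<open>A k\<close> accounts for the dependence of \<open>y\<^sub>0\<close> on \<open>y\<^sub>k\<close>.\<close>
  define y :: "real Matrix.vec \<Rightarrow> nat \<Rightarrow> real" where
    "y x k = (case k of 0 \<Rightarrow> 1 - (\<Sum>l<2 * d. coeff w (Suc l) * vec_index x l) | Suc l \<Rightarrow> vec_index x l)"
    for x k
  define A :: "nat \<Rightarrow> real mat" where
    "A k = Matrix.mat (Suc d) (Suc d) (\<lambda>(i, j). of_bool (i + j = k)
             - (if i + j = 0 \<and> k > 0 then coeff w k else 0))" for k
  define S where "S = {x \<in> carrier_vec (2 * d). hankel_psd d (y x)}"
  define f :: "real Matrix.vec \<Rightarrow> real^'n" where "f x = (\<chi> i. riesz (2 * d) (y x) (P i))" for x
  have split0: "riesz (2 * d) z p = coeff p 0 * z 0 + (\<Sum>l<2 * d. coeff p (Suc l) * z (Suc l))" for z p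
    by (simp only: riesz_def sum.atMost_shift)
  have "matrix_pencil (Suc d) (2 * d) A x = Matrix.mat (Suc d) (Suc d) (\<lambda>(i, j). y x (i + j))" for x
  proof -
    have "index_mat (A 0) (i, j) + (\<Sum>k<2 * d. vec_index x k * index_mat (A (Suc k)) (i, j)) = y x (i + j)"
      if "i < Suc d" "j < Suc d" for i j
    proof (cases "i + j")
      case 0
      then show ?thesis
        using that by (simp add: A_def y_def sum_negf mult.commute)
    next
      case (Suc l)
      then have "l < 2 * d"
        using that by linarith
      moreover have "index_mat (A 0) (i, j) = 0"
        "index_mat (A (Suc k)) (i, j) = (if k = l then 1 else 0)" for k
        using Suc that by (auto simp: A_def)
      ultimately show ?thesis
        by (simp add: Suc y_def if_distrib[of "\<lambda>x. _ * x"] cong: if_cong)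
    qed
    then show ?thesis
      unfolding matrix_pencil_def by (intro eq_matI) auto
  qed
  then have "S = {x \<in> carrier_vec (2 * d). psd_mat (Suc d) (matrix_pencil (Suc d) (2 * d) A x)}"
    unfolding S_def by (simp add: hankel_psd_mat_iff)
  moreover have "A k \<in> carrier_mat (Suc d) (Suc d) \<and> transpose_mat (A k) = A k" for k
    by (auto simp: A_def add.commute)
  ultimately have "spectrahedron (2 * d) S"
    unfolding spectrahedron_def by (intro exI[of _ "Suc d"] exI[of _ A]) simp
  moreover have "affine_map (2 * d) f"
    unfolding affine_map_def
  proof (intro exI ballI)
    fix x :: "real Matrix.vec"
    show "f x = (\<chi> i. coeff (P i) 0) + (\<Sum>k<2 * d. vec_index x k *\<^sub>R
                 (\<chi> i. coeff (P i) (Suc k) - coeff (P i) 0 * coeff w (Suc k)))"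
      by (simp add: f_def Finite_Cartesian_Product.vec_eq_iff split0 y_def)
        (simp add: algebra_simps sum_distrib_left sum_subtractf)
  qed
  moreover have "hankel_image d w P = f ` S"
  proof
    show "f ` S \<subseteq> hankel_image d w P"
    proof
      fix z assume "z \<in> f ` S"
      then obtain x where "x \<in> S" "z = f x"
        by auto
      moreover have "riesz (2 * d) (y x) w = 1"
        by (simp add: split0 y_def w0)
      ultimately show "z \<in> hankel_image d w P"
        unfolding hankel_image_def f_def S_def by blast
    qed
    show "hankel_image d w P \<subseteq> f ` S"
    proof
      fix z assume "z \<in> hankel_image d w P"
      then obtain u where z: "z = (\<chi> i. riesz (2 * d) u (P i))"
        and u: "hankel_psd d u" "riesz (2 * d) u w = 1"
        unfolding hankel_image_def by auto
      define x where "x = Matrix.vec (2 * d) (\<lambda>l. u (Suc l))"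
      have "y x 0 = u 0"
        using u(2) by (simp add: y_def x_def split0 w0)
      then have eq: "riesz (2 * d) (y x) p = riesz (2 * d) u p" for p
        by (simp add: split0) (simp add: y_def x_def)
      then have "x \<in> S"
        using u(1) by (simp add: S_def hankel_psd_def) (simp add: x_def)
      moreover have "z = f x"
        by (simp add: z f_def eq)
      ultimately show "z \<in> f ` S"
        by blast
    qed
  qed
  ultimately show ?thesis
    unfolding projected_spectrahedron_def by blast
qed

section \<open>Trigonometric polynomials as forms in the half angle\<close>

text \<open>
  The binary form of degree \<open>n\<close> with the coefficients of \<open>p\<close>. Working with the form instead of the
  values of \<open>p\<close> at \<open>s / c = tan (\<theta>/2)\<close> makes \<open>\<theta> = \<pi>\<close>, where \<open>c = 0\<close>, an ordinary point of the curve,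
  and presents evaluation at a point as a moment functional.
\<close>

definition form :: "nat \<Rightarrow> real poly \<Rightarrow> real \<Rightarrow> real \<Rightarrow> real" where
  "form n p c s = riesz n (\<lambda>k. c ^ (n - k) * s ^ k) p"

lemma form_dehomogenise:
  assumes "degree p \<le> n" "c \<noteq> 0"
  shows "form n p c s = c ^ n * poly p (s / c)"
proof -
  have "poly p (s / c) = (\<Sum>k\<le>n. coeff p k * (s / c) ^ k)"
    unfolding poly_altdef using assms(1)
    by (intro sum.mono_neutral_left) (auto simp: coeff_eq_0)
  also have "c ^ n * \<dots> = (\<Sum>k\<le>n. c ^ n * (coeff p k * (s / c) ^ k))"
    by (rule sum_distrib_left)
  also have "\<dots> = form n p c s"
    unfolding form_def riesz_def
  proof (intro sum.cong refl)
    fix k assume "k \<in> {..n}"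
    then show "c ^ n * (coeff p k * (s / c) ^ k) = coeff p k * (c ^ (n - k) * s ^ k)"
      using assms(2) by (simp add: power_diff power_divide field_simps)
  qed
  finally show ?thesis
    by simp
qed

lemma form_at_infinity: "form n p 0 s = coeff p n * s ^ n"
proof -
  have "form n p 0 s = (\<Sum>k\<le>n. if k = n then coeff p n * s ^ n else 0)"
    unfolding form_def riesz_def by (intro sum.cong) (auto simp: power_0_left)
  then show ?thesis
    by simp
qed

text \<open>
  Off \<open>c = 0\<close> this is multiplicativity of the evaluation at \<open>s / c\<close>; at \<open>c = 0\<close> only the top
  coefficients of the three forms survive.
\<close>

lemma form_mult:
  assumes "degree p \<le> m" "degree q \<le> n"
  shows "form (m + n) (p * q) c s = form m p c s * form n q c s"
proof (cases "c = 0")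
  case True
  have "coeff (p * q) (m + n) = coeff p m * coeff q n"
    using coeff_mult_degree_sum[of p q] assms
    by (cases "degree p = m \<and> degree q = n")
      (auto intro!: coeff_eq_0 le_less_trans[OF degree_mult_le] simp: coeff_eq_0)
  then show ?thesis
    using True by (simp add: form_at_infinity power_add)
next
  case False
  moreover have "degree (p * q) \<le> m + n"
    using degree_mult_le[of p q] assms by linarith
  ultimately show ?thesis
    using assms by (simp add: form_dehomogenise power_add)
qed

text \<open>
  The degree of the form is even because \<open>\<theta> + 2\<pi>\<close> has the half-angle coordinates \<open>(- c, - s)\<close>.
\<close>

definition half_angle :: "nat \<Rightarrow> real poly \<Rightarrow> (real \<Rightarrow> real) \<Rightarrow> bool" where
  "half_angle d p f \<longleftrightarrow> degree p \<le> 2 * d \<and> (\<forall>\<theta>. f \<theta> = form (2 * d) p (cos (\<theta> / 2)) (sin (\<theta> / 2)))"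

lemma half_angle_add:
  "half_angle d p f \<Longrightarrow> half_angle d q g \<Longrightarrow> half_angle d (p + q) (\<lambda>\<theta>. f \<theta> + g \<theta>)"
  by (simp add: half_angle_def form_def riesz_add degree_add_le)

lemma half_angle_mult:
  assumes "half_angle d p f" "half_angle e q g"
  shows "half_angle (d + e) (p * q) (\<lambda>\<theta>. f \<theta> * g \<theta>)"
  unfolding half_angle_def
proof (intro conjI allI)
  have deg: "degree p \<le> 2 * d" "degree q \<le> 2 * e"
    using assms by (simp_all add: half_angle_def)
  then show "degree (p * q) \<le> 2 * (d + e)"
    unfolding distrib_left by (intro order_trans[OF degree_mult_le] add_mono)
  show "f \<theta> * g \<theta> = form (2 * (d + e)) (p * q) (cos (\<theta> / 2)) (sin (\<theta> / 2))" for \<theta>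
    using assms unfolding distrib_left form_mult[OF deg] by (simp add: half_angle_def)
qed

lemma half_angle_const: "half_angle 0 [:c:] (\<lambda>\<theta>. c)"
  by (simp add: half_angle_def form_def riesz_def)

lemma half_angle_one: "half_angle 1 [:1, 0, 1:] (\<lambda>\<theta>. 1)"
  by (simp add: half_angle_def form_def riesz_def numeral_2_eq_2)

lemma half_angle_cos: "half_angle 1 [:1, 0, -1:] cos"
  unfolding half_angle_def
proof (intro conjI allI)
  fix \<theta> :: real
  show "cos \<theta> = form (2 * 1) [:1, 0, -1:] (cos (\<theta> / 2)) (sin (\<theta> / 2))"
    using cos_double[of "\<theta> / 2"] by (simp add: form_def riesz_def numeral_2_eq_2)
qed simp

lemma half_angle_sin: "half_angle 1 [:0, 2:] sin"
  unfolding half_angle_def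
proof (intro conjI allI)
  fix \<theta> :: real
  show "sin \<theta> = form (2 * 1) [:0, 2:] (cos (\<theta> / 2)) (sin (\<theta> / 2))"
    using sin_double[of "\<theta> / 2"] by (simp add: form_def riesz_def numeral_2_eq_2)
qed simp

text \<open>Multiplication by \<open>1 = c\<^sup>2 + s\<^sup>2\<close> raises the degree of a form by two.\<close>

lemma half_angle_mono:
  assumes "half_angle d p f" "d \<le> e"
  shows "\<exists>q. half_angle e q f"
  using assms(2)
proof (induction e rule: dec_induct)
  case base
  then show ?case
    using assms(1) by blast
next
  case (step n)
  then show ?case
    using half_angle_mult[OF _ half_angle_one] by fastforce
qed

lemma trigonometric_polynomial_half_angle:
  assumes "trigonometric_polynomial f"
  shows "\<exists>d p. half_angle d p f"
proof -
  have add: "\<exists>d p. half_angle d p (\<lambda>\<theta>. g \<theta> + h \<theta>)"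
    if "\<exists>d p. half_angle d p g" "\<exists>d p. half_angle d p h" for g h
    using that half_angle_mono half_angle_add by (metis linorder_linear)
  have mult: "\<exists>d p. half_angle d p (\<lambda>\<theta>. g \<theta> * h \<theta>)"
    if "\<exists>d p. half_angle d p g" "\<exists>d p. half_angle d p h" for g h
    using that half_angle_mult by blast
  have inner: "\<exists>d p. half_angle d p (\<lambda>\<theta>. poly a (cos \<theta>))" for a
  proof (induction a)
    case 0
    then show ?case
      using half_angle_const[of 0] by auto
  next
    case (pCons c a)
    have "\<exists>d p. half_angle d p (\<lambda>\<theta>. cos \<theta> * poly a (cos \<theta>))"
      using half_angle_cos by (intro mult[OF _ pCons.IH]) blast
    moreover have "\<exists>d p. half_angle d p (\<lambda>_. c)"
      using half_angle_const by blast
    ultimately have "\<exists>d p. half_angle d p (\<lambda>\<theta>. c + cos \<theta> * poly a (cos \<theta>))"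
      by (intro add)
    then show ?case
      by simp
  qed
  have "\<exists>d q. half_angle d q (\<lambda>\<theta>. poly (poly p [:sin \<theta>:]) (cos \<theta>))" for p
  proof (induction p)
    case 0
    then show ?case
      using half_angle_const[of 0] by auto
  next
    case (pCons a p)
    have "\<exists>d q. half_angle d q (\<lambda>\<theta>. sin \<theta> * poly (poly p [:sin \<theta>:]) (cos \<theta>))"
      using half_angle_sin by (intro mult[OF _ pCons.IH]) blast
    from add[OF inner this] show ?case
      by simp
  qed
  moreover obtain p where "f = (\<lambda>\<theta>. poly (poly p [:sin \<theta>:]) (cos \<theta>))"
    using assms unfolding trigonometric_polynomial_def by blast
  ultimately show ?thesis
    by simp
qed

section \<open>Convex hulls of trigonometric curves\<close>

text \<open>
  Evaluation at an angle sends \<open>g\<^sup>2\<close> to the square of a form, which gives one inclusion. The other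
  is duality: an inequality that holds strictly on the curve is a sum of two squares, and every
  functional with positive semidefinite Hankel matrix respects it.
\<close>

lemma hankel_image_eq_convex_hull:
  fixes P :: "'n::finite \<Rightarrow> real poly"
  assumes P: "\<And>i. half_angle d (P i) (f i)" and w: "half_angle d w (\<lambda>_. 1)"
    and compact: "compact (range (\<lambda>\<theta>. \<chi> i. f i \<theta>))"
  shows "hankel_image d w P = convex hull (range (\<lambda>\<theta>. \<chi> i. f i \<theta>))"
proof
  show "convex hull (range (\<lambda>\<theta>. \<chi> i. f i \<theta>)) \<subseteq> hankel_image d w P"
  proof (intro hull_minimal convex_hankel_image subsetI)
    fix x assume "x \<in> range (\<lambda>\<theta>. \<chi> i. f i \<theta>)"
    then obtain \<theta> where x: "x = (\<chi> i. f i \<theta>)"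
      by auto
    let ?y = "\<lambda>k. cos (\<theta> / 2) ^ (2 * d - k) * sin (\<theta> / 2) ^ k"
    have "hankel_psd d ?y"
      unfolding hankel_psd_def
      by (auto simp flip: form_def mult_2 simp: form_mult[of _ d _ d, folded mult_2])
    moreover have "riesz (2 * d) ?y w = 1" "\<And>i. riesz (2 * d) ?y (P i) = f i \<theta>"
      using P w by (auto simp: half_angle_def form_def)
    ultimately show "x \<in> hankel_image d w P"
      unfolding hankel_image_def x by (intro CollectI exI[of _ ?y] conjI) simp_all
  qed
next
  show "hankel_image d w P \<subseteq> convex hull (range (\<lambda>\<theta>. \<chi> i. f i \<theta>))"
  proof (rule subsetI, rule ccontr)
    fix x assume "x \<in> hankel_image d w P" and out: "x \<notin> convex hull (range (\<lambda>\<theta>. \<chi> i. f i \<theta>))"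
    then obtain y where x: "x = (\<chi> i. riesz (2 * d) y (P i))"
      and y: "hankel_psd d y" "riesz (2 * d) y w = 1"
      unfolding hankel_image_def by auto
    obtain a b where below: "inner a x < b"
      and above: "\<forall>z \<in> convex hull (range (\<lambda>\<theta>. \<chi> i. f i \<theta>)). inner a z > b"
      using separating_hyperplane_closed_point[OF _ _ out] compact
      by (metis convex_convex_hull compact_convex_hull compact_imp_closed)
    define q where "q = (\<Sum>i\<in>UNIV. Polynomial.smult (vec_nth a i) (P i)) - Polynomial.smult b w"
    have deg: "degree q \<le> 2 * d"
      unfolding q_def using P w
      by (intro degree_diff_le degree_sum_le) (auto simp: half_angle_def intro: order_trans[OF degree_smult_le])
    have "form (2 * d) q (cos (\<theta> / 2)) (sin (\<theta> / 2)) > 0" for \<theta>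
    proof -
      have "form (2 * d) q (cos (\<theta> / 2)) (sin (\<theta> / 2)) = (\<Sum>i\<in>UNIV. vec_nth a i * f i \<theta>) - b"
        using P w by (simp add: q_def form_def riesz_diff riesz_sum riesz_smult half_angle_def)
      also have "\<dots> = inner a (\<chi> i. f i \<theta>) - b"
        by (simp add: inner_vec_def)
      also have "\<dots> > 0"
        using above by (simp add: hull_inc)
      finally show ?thesis .
    qed
    \<comment> \<open>The angle \<open>2 arctan t\<close> has half-angle slope \<open>s / c = t\<close>.\<close>
    then have "form (2 * d) q (cos (arctan t)) (sin (arctan t)) > 0" for t
      by (metis nonzero_mult_div_cancel_left zero_neq_numeral)
    then have "poly q t > 0" for t
      using form_dehomogenise[OF deg, of "cos (arctan t)" "sin (arctan t)"]
        tan_arctan[of t] cos_arctan_not_zero[of t]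
      by (metis tan_def zero_less_mult_iff zero_le_even_power dvd_triv_left not_less)
    then obtain g h where "q = g * g + h * h" "2 * degree g \<le> degree q" "2 * degree h \<le> degree q"
      using pos_poly_sum_two_squares by blast
    then have "riesz (2 * d) y q \<ge> 0"
      using y(1) deg by (auto simp: hankel_psd_def riesz_add)
    moreover have "riesz (2 * d) y q = inner a x - b"
      by (simp add: q_def riesz_diff riesz_sum riesz_smult y(2) x inner_vec_def)
    ultimately show False
      using below by simp
  qed
qed

text \<open>
  A trigonometric polynomial depends on \<open>\<theta>\<close> only through the point \<open>(cos \<theta>, sin \<theta>)\<close> of the
  circle, so the angles may range over the whole line as well as over a compact interval.
\<close>

lemma trigonometric_curve_range:
  fixes f :: "'n::finite \<Rightarrow> real \<Rightarrow> real"
  assumes f: "\<And>i. trigonometric_polynomial (f i)"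
  shows "(\<lambda>\<theta>. \<chi> i. f i \<theta>) ` {0..<2 * pi} = range (\<lambda>\<theta>. \<chi> i. f i \<theta>)"
    and "compact (range (\<lambda>\<theta>. \<chi> i. f i \<theta>))"
proof -
  have per: "\<exists>\<theta>'\<in>{0..<2 * pi}. (\<chi> i. f i \<theta>) = (\<chi> i. f i \<theta>')" for \<theta>
  proof -
    obtain \<theta>' where \<theta>': "0 \<le> \<theta>'" "\<theta>' < 2 * pi" "cos \<theta> = cos \<theta>'" "sin \<theta> = sin \<theta>'"
      using sincos_total_2pi[of "cos \<theta>" "sin \<theta>"] by auto
    have "f i \<theta> = f i \<theta>'" for i
      using f[of i] \<theta>'(3,4) unfolding trigonometric_polynomial_def by auto
    then show ?thesis
      using \<theta>' by auto
  qed
  then show "(\<lambda>\<theta>. \<chi> i. f i \<theta>) ` {0..<2 * pi} = range (\<lambda>\<theta>. \<chi> i. f i \<theta>)"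
    by (auto simp: image_iff)
  have "continuous_on UNIV (f i)" for i
  proof -
    obtain d p where "half_angle d p (f i)"
      using trigonometric_polynomial_half_angle f by blast
    then have "f i = (\<lambda>\<theta>. form (2 * d) p (cos (\<theta> / 2)) (sin (\<theta> / 2)))"
      by (auto simp: half_angle_def)
    then show ?thesis
      by (simp only: form_def riesz_def) (intro continuous_intros; simp)
  qed
  then have "compact ((\<lambda>\<theta>. \<chi> i. f i \<theta>) ` {0..2 * pi})"
    by (intro compact_continuous_image continuous_on_vec_lambda)
      (auto intro: continuous_on_subset)
  moreover have "range (\<lambda>\<theta>. \<chi> i. f i \<theta>) = (\<lambda>\<theta>. \<chi> i. f i \<theta>) ` {0..2 * pi}"
    using per by (force simp: image_iff)
  ultimately show "compact (range (\<lambda>\<theta>. \<chi> i. f i \<theta>))"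
    by simp
qed

lemma convex_hull_trigonometric_curve:
  fixes C :: "(real^'n) set"
  assumes "trigonometric_curve C"
  shows "projected_spectrahedron (convex hull C)"
proof -
  obtain f where f: "\<And>i. trigonometric_polynomial (f i)"
    and C: "C = (\<lambda>\<theta>. \<chi> i. f i \<theta>) ` {0..<2 * pi}"
    using assms unfolding trigonometric_curve_def by blast
  have "\<forall>i. \<exists>d p. half_angle d p (f i)"
    using trigonometric_polynomial_half_angle f by blast
  then obtain D where D: "\<And>i. \<exists>p. half_angle (D i) p (f i)"
    by metis
  define d where "d = Max (range D)"
  have "\<exists>p. half_angle d p (f i)" for i
  proof -
    have "D i \<le> d"
      by (simp add: d_def)
    then show ?thesis
      using D half_angle_mono by blast
  qed
  then obtain P where P: "\<And>i. half_angle d (P i) (f i)"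
    by metis
  obtain w where w: "half_angle d w (\<lambda>_. 1)"
    using half_angle_mono[OF half_angle_const] by blast
  \<comment> \<open>The angle \<open>0\<close> has \<open>(c, s) = (1, 0)\<close>, where a form takes its constant coefficient as value.\<close>
  have "1 = form (2 * d) w (cos (0 / 2)) (sin (0 / 2))"
    using w by (simp only: half_angle_def)
  then have "coeff w 0 = 1"
    using w by (simp add: half_angle_def form_dehomogenise poly_0_coeff_0)
  then have "projected_spectrahedron (hankel_image d w P)"
    by (rule hankel_image_projected_spectrahedron)
  then show ?thesis
    using hankel_image_eq_convex_hull[of d P f w] P w trigonometric_curve_range[of f] f C by simp
qed

section \<open>Caratheodory orbitopes\<close>

lemma trigonometric_polynomial_ops:
  assumes "trigonometric_polynomial f" "trigonometric_polynomial g"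
  shows trigonometric_polynomial_add: "trigonometric_polynomial (\<lambda>\<theta>. f \<theta> + g \<theta>)"
    and trigonometric_polynomial_diff: "trigonometric_polynomial (\<lambda>\<theta>. f \<theta> - g \<theta>)"
    and trigonometric_polynomial_mult: "trigonometric_polynomial (\<lambda>\<theta>. f \<theta> * g \<theta>)"
proof -
  obtain p q where "f = (\<lambda>\<theta>. poly (poly p [:sin \<theta>:]) (cos \<theta>))" "g = (\<lambda>\<theta>. poly (poly q [:sin \<theta>:]) (cos \<theta>))"
    using assms unfolding trigonometric_polynomial_def by blast
  then show "trigonometric_polynomial (\<lambda>\<theta>. f \<theta> + g \<theta>)" "trigonometric_polynomial (\<lambda>\<theta>. f \<theta> - g \<theta>)"
    "trigonometric_polynomial (\<lambda>\<theta>. f \<theta> * g \<theta>)"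
    unfolding trigonometric_polynomial_def
    by (auto intro: exI[of _ "p + q"] exI[of _ "p - q"] exI[of _ "p * q"])
qed

lemma trigonometric_polynomial_multiple_angle:
  "trigonometric_polynomial (\<lambda>\<theta>. cos (real n * \<theta>)) \<and> trigonometric_polynomial (\<lambda>\<theta>. sin (real n * \<theta>))"
proof (induction n)
  case 0
  have "trigonometric_polynomial (\<lambda>_. 1)" "trigonometric_polynomial (\<lambda>_. 0)"
    unfolding trigonometric_polynomial_def by (auto intro: exI[of _ 1] exI[of _ 0])
  then show ?case
    by simp
next
  case (Suc n)
  have "trigonometric_polynomial cos"
    unfolding trigonometric_polynomial_def by (intro exI[of _ "[:[:0, 1:]:]"]) simp
  moreover have "trigonometric_polynomial sin"
    unfolding trigonometric_polynomial_def by (intro exI[of _ "[:0, 1:]"]) simp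
  ultimately have
    "trigonometric_polynomial (\<lambda>\<theta>. cos (real n * \<theta>) * cos \<theta> - sin (real n * \<theta>) * sin \<theta>)"
    "trigonometric_polynomial (\<lambda>\<theta>. sin (real n * \<theta>) * cos \<theta> + cos (real n * \<theta>) * sin \<theta>)"
    using Suc.IH by (intro trigonometric_polynomial_ops; blast)+
  then show ?case
    by (simp add: distrib_right add.commute[of 1] flip: cos_add sin_add)
qed

theorem corollary5p3:
  shows "(\<forall>C :: (real^'n) set. trigonometric_curve C \<longrightarrow> projected_spectrahedron (convex hull C)) \<and>
         (\<forall>a :: nat^'d. projected_spectrahedron (caratheodory_orbitope a))"
proof (intro conjI allI impI)
  fix C :: "(real^'n) set"
  assume "trigonometric_curve C"
  then show "projected_spectrahedron (convex hull C)"
    by (rule convex_hull_trigonometric_curve)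
next
  fix a :: "nat^'d"
  define f :: "'d \<times> 2 \<Rightarrow> real \<Rightarrow> real" where
    "f p \<theta> = (if snd p = 1 then cos (real (vec_nth a (fst p)) * \<theta>)
               else sin (real (vec_nth a (fst p)) * \<theta>))" for p \<theta>
  have "trigonometric_polynomial (f p)" for p
    unfolding f_def using trigonometric_polynomial_multiple_angle by (cases "snd p = 1") simp_all
  then have "trigonometric_curve ((\<lambda>\<theta>. \<chi> p. f p \<theta>) ` {0..<2 * pi})"
    unfolding trigonometric_curve_def by blast
  then show "projected_spectrahedron (caratheodory_orbitope a)"
    unfolding caratheodory_orbitope_def f_def by (rule convex_hull_trigonometric_curve)
qed

end
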